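(* Let $h,b\in\mathbb{S}^2$ be the components of a reference vector in the reference and body coordinate systems respectively, and let $f=h-b$, $g=h+b$. Let $\check p=[p_0\; p_1\; p_2\; p_3]^T$, with vector part $p=[p_1\;p_2\;p_3]^T$, be the attitude quaternion estimate obtained by integrating the angular velocity of a rigid body. Let $$\kappa=\frac{p_0\,g^Tg+p^T(g\times f)}{p_0(g_1f_2-g_2f_1)+p_1(g_1g_3-f_1f_3)+p_2(g_2g_3-f_2f_3)+p_3(f_1^2+f_2^2+g_3^2)},$$ $$n_3=\frac{g_3}{\sqrt{g^Tg+2\kappa(f_1g_2-f_2g_1)+\kappa^2(f_1^2+f_2^2)}},\qquad \frac{c}{s}=\frac{\kappa g_3}{\sqrt{g^Tg+2\kappa(f_1g_2-f_2g_1)+\kappa^2(f_1^2+f_2^2)}},$$ where $c^2+s^2=1$, i.e. $s=1/\sqrt{(c/s)^2+1}$ and $c=(c/s)\,s$. Assume that $g_3\neq 0$ and that the denominator of $\kappa$ is nonzero, so that these expressions are defined. Then the attitude estimate $\check q\in Q_b$ lying in the feasibility cone of the measurement $b$ which is closest to $\check p$ is given, up to the overall sign of the quaternion (which does not affect the attitude), by $$\check q=\begin{bmatrix} c\\ (-cf_2+sn_3g_1)/g_3\\ (cf_1+sn_3g_2)/g_3\\ sn_3\end{bmatrix}.$$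
   Context: $\mathbb{S}^2$ and $\mathbb{S}^3$ are the unit spheres of $\mathbb{R}^3$ and $\mathbb{R}^4$. A quaternion is written $\check q=[q_0\; q^T]^T$ with scalar part $q_0\in\mathbb{R}$ and vector part $q\in\mathbb{R}^3$; the product is $\check q\otimes\check p=[\,q_0p_0-q^Tp,\; (q_0p+p_0q+q\times p)^T]^T$. An attitude quaternion is a unit quaternion; $\check q$ and $-\check q$ represent the same rotation. For $v\in\mathbb{R}^3$, $\check v=[0\; v^T]^T$. The feasibility cone of the measurement $b$ for the reference vector $h$ is $Q_b=\{\check q\in\mathbb{S}^3:\check q\otimes\check b=\check h\otimes\check q\}$. The angular velocity $\omega$ (body components) is integrated through the kinematic equation $\dot{\check q}=\tfrac12\check q\otimes\check\omega$ to produce the attitude quaternion $\check p\in\mathbb{S}^3$; for the claim, $\check p$ may be regarded as a given unit quaternion. "Closest to $\check p$" means minimizing over $Q_b$ the Euclidean distance $\|\check q-\check p\|=\|\check p^{-1}\otimes\check q-\check 1\|$, with $\check 1=[1\;0\;0\;0]^T$. *)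

theory Defs
  imports "HOL-Analysis.Analysis"
begin

text \<open>
  A quaternion is a vector of \<open>real^4\<close>: component \<open>1\<close> is the scalar part and components
  \<open>2, 3, 4\<close> are the vector part (indices are shifted by one from \<open>q\<^sub>0, \<dots>, q\<^sub>3\<close>).
  The norm and distance are then the Euclidean ones, and \<open>sphere 0 1\<close> is the unit 3-sphere.
\<close>

definition quat :: "real \<Rightarrow> real^3 \<Rightarrow> real^4"
  where "quat a v = vector [a, v$1, v$2, v$3]"

definition scalar_part :: "real^4 \<Rightarrow> real"
  where "scalar_part q = q$1"

definition vector_part :: "real^4 \<Rightarrow> real^3"
  where "vector_part q = vector [q$2, q$3, q$4]"

definition quat_mult :: "real^4 \<Rightarrow> real^4 \<Rightarrow> real^4"  (infixl \<open>\<otimes>\<close> 70)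
  where "q \<otimes> p =
    quat (scalar_part q * scalar_part p - vector_part q \<bullet> vector_part p)
         (scalar_part q *\<^sub>R vector_part p + scalar_part p *\<^sub>R vector_part q
            + cross3 (vector_part q) (vector_part p))"

definition feasibility_cone :: "real^3 \<Rightarrow> real^3 \<Rightarrow> (real^4) set"
  where "feasibility_cone h b = {q \<in> sphere 0 1. q \<otimes> quat 0 b = quat 0 h \<otimes> q}"

definition closest_points :: "'a::metric_space \<Rightarrow> 'a set \<Rightarrow> 'a set"
  where "closest_points x S = {q. is_arg_min (\<lambda>y. dist y x) (\<lambda>y. y \<in> S) q}"

lemma vector_4 [simp]:
  "(vector [x, y, z, w] :: 'a::zero^4) $ 1 = x"
  "(vector [x, y, z, w] :: 'a::zero^4) $ 2 = y"
  "(vector [x, y, z, w] :: 'a::zero^4) $ 3 = z"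
  "(vector [x, y, z, w] :: 'a::zero^4) $ 4 = w"
  unfolding vector_def by simp_all

lemma quat_parts [simp]:
  "scalar_part (quat a v) = a" "vector_part (quat a v) = v"
  by (simp_all add: scalar_part_def vector_part_def quat_def vec_eq_iff forall_3)

lemma quat_collapse [simp]: "quat (scalar_part q) (vector_part q) = q"
  by (simp add: scalar_part_def vector_part_def quat_def vec_eq_iff forall_4)

end

theory Submission
  imports Defs
begin

text \<open>
  The cone is the intersection of the unit sphere with the plane spanned by
  \<open>u = (g\<^sub>3, -f\<^sub>2, f\<^sub>1, 0)\<close> and \<open>v = (0, g)\<close>. On the sphere, minimizing the distance to \<open>p\<close> is
  maximizing the inner product with \<open>p\<close>, or with the projection of \<open>p\<close> to that plane. So the
  minimizer is the normalized projection. By Cramer's rule for the Gram matrix of \<open>u, v\<close>, the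
  projection is a multiple of \<open>\<kappa> u + v\<close>, and the stated quaternion is \<open>\<kappa> u + v\<close> normalized.
\<close>

text \<open>Equality case of Cauchy-Schwarz; it will make the minimizer unique.\<close>

lemma inner_eq_norm_imp_eq_sgn:
  fixes w q :: "'a::real_inner"
  assumes "norm q = 1" and "w \<bullet> q = norm w" and "w \<noteq> 0"
  shows "q = sgn w"
proof -
  have "w \<bullet> q = norm w * norm q"
    using assms by simp
  then have "norm w *\<^sub>R q = w"
    unfolding norm_cauchy_schwarz_eq using assms(1) by simp
  then have "(1 / norm w) *\<^sub>R (norm w *\<^sub>R q) = sgn w"
    by (simp add: sgn_div_norm divide_inverse_commute)
  then show ?thesis
    using assms(3) by simp
qed

text \<open>For unit q the squared distance to p is 1 + p \<bullet> p - 2 (p \<bullet> q), so only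
  inner products with points of \<open>S\<close> matter. Hence p may be replaced by any
  \<open>w\<close> that is, up to a positive factor, indistinguishable from p on \<open>S\<close>.
  Cauchy-Schwarz then bounds w \<bullet> q by \<open>norm w\<close>, attained only at
  \<open>sgn w\<close>.\<close>

lemma closest_points_sphere:
  fixes p w :: "'a::real_inner"
  assumes S: "S \<subseteq> sphere 0 1"
    and inner: "\<And>q. q \<in> S \<Longrightarrow> p \<bullet> q = t * (w \<bullet> q)"
    and "0 < t" and "w \<noteq> 0" and mem: "sgn w \<in> S"
  shows "closest_points p S = {sgn w}"
proof -
  have dist_le: "dist x p \<le> dist y p \<longleftrightarrow> w \<bullet> y \<le> w \<bullet> x" if "x \<in> S" "y \<in> S" for x y
  proof -
    have "(dist q p)\<^sup>2 = 1 + p \<bullet> p - 2 * (t * (w \<bullet> q))" if "q \<in> S" for q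
    proof -
      have "q \<bullet> q = 1"
        using S that by (auto simp: dot_square_norm)
      then show ?thesis
        using inner[OF that]
        by (simp add: dist_norm power2_norm_eq_inner inner_diff inner_commute)
    qed
    moreover have "dist x p \<le> dist y p \<longleftrightarrow> (dist x p)\<^sup>2 \<le> (dist y p)\<^sup>2"
      by simp
    ultimately show ?thesis
      using that \<open>0 < t\<close> by simp
  qed
  have sgn: "w \<bullet> sgn w = norm w"
    using \<open>w \<noteq> 0\<close> by (simp add: sgn_div_norm dot_square_norm power2_eq_square)
  have le: "w \<bullet> q \<le> norm w" if "q \<in> S" for q
    using norm_cauchy_schwarz[of w q] S that by auto
  have "is_arg_min (\<lambda>y. dist y p) (\<lambda>y. y \<in> S) q \<longleftrightarrow> q = sgn w" for q
  proof
    assume "is_arg_min (\<lambda>y. dist y p) (\<lambda>y. y \<in> S) q"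
    then have "q \<in> S" and "dist q p \<le> dist (sgn w) p"
      using mem by (auto simp: is_arg_min_linorder)
    then have "w \<bullet> q = norm w"
      using dist_le mem sgn le by fastforce
    then show "q = sgn w"
      using \<open>q \<in> S\<close> S \<open>w \<noteq> 0\<close> by (intro inner_eq_norm_imp_eq_sgn) auto
  next
    assume "q = sgn w"
    then show "is_arg_min (\<lambda>y. dist y p) (\<lambda>y. y \<in> S) q"
      using dist_le mem sgn le by (auto simp: is_arg_min_linorder)
  qed
  then show ?thesis
    by (auto simp: closest_points_def)
qed

lemma span_doubletonE:
  fixes u v :: "'a::real_vector"
  assumes "x \<in> span {u, v}"
  obtains a b where "x = a *\<^sub>R u + b *\<^sub>R v"
proof -
  obtain a b where "x - a *\<^sub>R u = b *\<^sub>R v"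
    using assms by (auto simp: span_insert span_singleton)
  then have "x = a *\<^sub>R u + b *\<^sub>R v"
    by (simp add: diff_eq_eq add.commute)
  then show thesis
    by (rule that)
qed

text \<open>The coefficients in \<open>w\<close> are Cramer's numerators, not divided by the Gram
  determinant. So the single hypothesis w \<noteq> 0 excludes both dependent u, v and a p orthogonal
  to the plane.\<close>

lemma closest_points_sphere_Int_span2:
  fixes p u v :: "'a::real_inner"
  defines "w \<equiv> ((p \<bullet> u) * (v \<bullet> v) - (p \<bullet> v) * (u \<bullet> v)) *\<^sub>R u
             + ((p \<bullet> v) * (u \<bullet> u) - (p \<bullet> u) * (u \<bullet> v)) *\<^sub>R v"
  assumes "w \<noteq> 0"
  shows "closest_points p (sphere 0 1 \<inter> span {u, v}) = {sgn w}"
proof -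
  define \<Delta> where "\<Delta> = (u \<bullet> u) * (v \<bullet> v) - (u \<bullet> v)\<^sup>2"
  have wu: "w \<bullet> u = \<Delta> * (p \<bullet> u)" and wv: "w \<bullet> v = \<Delta> * (p \<bullet> v)"
    by (simp_all add: w_def \<Delta>_def inner_add inner_commute power2_eq_square algebra_simps)
  \<comment> \<open>If the Gram determinant vanished, \<open>w\<close> would be orthogonal to u and
    v, hence to itself, being a combination of them.\<close>
  have "\<Delta> \<noteq> 0"
  proof
    assume "\<Delta> = 0"
    then have "w \<bullet> w = 0"
      using wu wv by (subst (2) w_def) (simp add: inner_add)
    then show False
      using \<open>w \<noteq> 0\<close> by simp
  qed
  then have "\<Delta> > 0"
    using Cauchy_Schwarz_ineq[of u v] by (simp add: \<Delta>_def)
  have in_span: "w \<in> span {u, v}"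
    unfolding w_def by (intro span_add span_scale span_base) auto
  show ?thesis
  proof (rule closest_points_sphere)
    show "p \<bullet> q = (1 / \<Delta>) * (w \<bullet> q)" if "q \<in> sphere 0 1 \<inter> span {u, v}" for q
    proof -
      from that have "q \<in> span {u, v}"
        by simp
      then obtain a b where "q = a *\<^sub>R u + b *\<^sub>R v"
        by (rule span_doubletonE)
      then show ?thesis
        using \<open>\<Delta> > 0\<close> wu wv by (simp add: inner_add field_simps)
    qed
    show "sgn w \<in> sphere 0 1 \<inter> span {u, v}"
      using \<open>w \<noteq> 0\<close> in_span by (simp add: norm_sgn sgn_div_norm span_scale)
  qed (use \<open>\<Delta> > 0\<close> \<open>w \<noteq> 0\<close> in auto)
qed

text \<open>Compare scalar and vector parts; anticommutativity turns the cross product with h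
  around, so that both cross products merge into one with h + b.\<close>

lemma quat_mult_eq_iff:
  "q \<otimes> quat 0 b = quat 0 h \<otimes> q \<longleftrightarrow>
     vector_part q \<bullet> (h - b) = 0 \<and>
     scalar_part q *\<^sub>R (h - b) = cross3 (vector_part q) (h + b)"
  by (auto simp: quat_mult_def scalar_part_def vector_part_def quat_def cross3_def vec_eq_iff
      forall_3 forall_4 inner_vec_def sum_3 algebra_simps)

text \<open>Since g$3 \<noteq> 0, the first two components of the cross product equation determine
  \<open>q$2\<close> and \<open>q$3\<close> from \<open>q$1\<close> and \<open>q$4\<close>. The
  other two equations then follow from f \<bullet> g = 0, which is where equal norms enter.\<close>

lemma feasibility_cone_eq_sphere_Int_span:
  fixes h b f g :: "real^3"
  assumes "norm h = norm b" and f: "f = h - b" and g: "g = h + b" and "g$3 \<noteq> 0"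
  shows "feasibility_cone h b =
           sphere 0 1 \<inter> span {vector [g$3, - f$2, f$1, 0], quat 0 g}" (is "_ = _ \<inter> span {?u, ?v}")
proof -
  have "f \<bullet> g = 0"
    using \<open>norm h = norm b\<close> by (simp add: f g inner_add inner_diff dot_square_norm inner_commute)
  then have fg: "f$1 * g$1 + f$2 * g$2 + f$3 * g$3 = 0"
    by (simp add: inner_vec_def sum_3)
  have "q \<otimes> quat 0 b = quat 0 h \<otimes> q \<longleftrightarrow> q \<in> span {?u, ?v}" for q
  proof
    assume "q \<otimes> quat 0 b = quat 0 h \<otimes> q"
    then have "scalar_part q *\<^sub>R f = cross3 (vector_part q) g"
      by (simp add: quat_mult_eq_iff f g)
    \<comment> \<open>The coefficients are read off from components 1 and 4: in each, one spanning
      vector has entry \<open>g$3\<close> and the other 0.\<close>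
    then have "q = (q$1 / g$3) *\<^sub>R ?u + (q$4 / g$3) *\<^sub>R ?v"
      using \<open>g$3 \<noteq> 0\<close>
      by (simp add: vec_eq_iff forall_3 forall_4 cross3_def scalar_part_def vector_part_def
          quat_def field_simps)
    then show "q \<in> span {?u, ?v}"
      by (metis insertCI span_add span_base span_scale)
  next
    assume "q \<in> span {?u, ?v}"
    then obtain x y where q: "q = x *\<^sub>R ?u + y *\<^sub>R ?v"
      by (rule span_doubletonE)
    have "vector_part q \<bullet> f = y * (f$1 * g$1 + f$2 * g$2 + f$3 * g$3)"
      by (simp add: q vector_part_def quat_def inner_vec_def sum_3 algebra_simps)
    moreover have "cross3 (vector_part q) g - scalar_part q *\<^sub>R f =
        vector [0, 0, - x * (f$1 * g$1 + f$2 * g$2 + f$3 * g$3)]"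
      by (simp add: q scalar_part_def vector_part_def quat_def cross3_def vec_eq_iff forall_3
          algebra_simps)
    moreover have "vector [0, 0, 0] = (0 :: real^3)"
      by (simp add: vec_eq_iff forall_3)
    ultimately show "q \<otimes> quat 0 b = quat 0 h \<otimes> q"
      by (simp add: quat_mult_eq_iff fg flip: f g)
  qed
  then show ?thesis
    by (auto simp: feasibility_cone_def)
qed

theorem theorem9:
  fixes h b f g p :: "real^3" and p\<^sub>0 \<kappa> den n\<^sub>3 ratio c s :: real
  assumes "h \<in> sphere 0 1" and "b \<in> sphere 0 1"
    and "f = h - b" and "g = h + b"
    and "quat p\<^sub>0 p \<in> sphere 0 1"
    and "den = p\<^sub>0 * (g$1 * f$2 - g$2 * f$1) + p$1 * (g$1 * g$3 - f$1 * f$3)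
             + p$2 * (g$2 * g$3 - f$2 * f$3) + p$3 * ((f$1)\<^sup>2 + (f$2)\<^sup>2 + (g$3)\<^sup>2)"
    and "\<kappa> = (p\<^sub>0 * (g \<bullet> g) + p \<bullet> cross3 g f) / den"
    and "n\<^sub>3 = g$3 / sqrt (g \<bullet> g + 2 * \<kappa> * (f$1 * g$2 - f$2 * g$1)
                         + \<kappa>\<^sup>2 * ((f$1)\<^sup>2 + (f$2)\<^sup>2))"
    and "ratio = \<kappa> * g$3 / sqrt (g \<bullet> g + 2 * \<kappa> * (f$1 * g$2 - f$2 * g$1)
                         + \<kappa>\<^sup>2 * ((f$1)\<^sup>2 + (f$2)\<^sup>2))"
    and "s = 1 / sqrt (ratio\<^sup>2 + 1)" and "c = ratio * s"
    and "g$3 \<noteq> 0" and "den \<noteq> 0"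
  shows "\<exists>\<sigma> \<in> {1, -1}. closest_points (quat p\<^sub>0 p) (feasibility_cone h b) =
           {\<sigma> *\<^sub>R vector [c,
                         (- c * f$2 + s * n\<^sub>3 * g$1) / g$3,
                         (c * f$1 + s * n\<^sub>3 * g$2) / g$3,
                         s * n\<^sub>3]}"
proof -
  define P where "P = quat p\<^sub>0 p"
  define u :: "real^4" where "u = vector [g$3, - f$2, f$1, 0]"
  define v where "v = quat 0 g"
  define z where "z = \<kappa> *\<^sub>R u + v"
  \<comment> \<open>\<open>R\<close> turns out to be the norm of the vector part of
    \<open>z\<close>, whose scalar part is \<kappa> * g$3. Thus \<open>ratio\<close> is the
    cotangent of the half angle and \<open>n\<^sub>3\<close> the third component of the unit
    rotation axis.\<close>
  define R where "R = sqrt (g \<bullet> g + 2 * \<kappa> * (f$1 * g$2 - f$2 * g$1)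
                         + \<kappa>\<^sup>2 * ((f$1)\<^sup>2 + (f$2)\<^sup>2))"
  have "norm h = norm b"
    using assms(1,2) by simp
  then have "f \<bullet> g = 0"
    by (simp add: assms(3,4) inner_add inner_diff dot_square_norm inner_commute)
  then have fg: "f$1 * g$1 + f$2 * g$2 + f$3 * g$3 = 0"
    by (simp add: inner_vec_def sum_3)
  have uu: "u \<bullet> u = (g$3)\<^sup>2 + (f$1)\<^sup>2 + (f$2)\<^sup>2" and vv: "v \<bullet> v = g \<bullet> g"
    and uv: "u \<bullet> v = f$1 * g$2 - f$2 * g$1"
    and Pu: "P \<bullet> u = p\<^sub>0 * g$3 - p$1 * f$2 + p$2 * f$1"
    and Pv: "P \<bullet> v = p$1 * g$1 + p$2 * g$2 + p$3 * g$3"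
    by (simp_all add: u_def v_def P_def quat_def inner_vec_def sum_3 sum_4 power2_eq_square)
  have gg: "g \<bullet> g = (g$1)\<^sup>2 + (g$2)\<^sup>2 + (g$3)\<^sup>2"
    by (simp add: inner_vec_def sum_3 power2_eq_square)
  \<comment> \<open>Modulo f \<bullet> g = 0, the two Cramer coefficients are \<open>g$3\<close>
    times the denominator and the numerator of \<kappa>.\<close>
  have "(P \<bullet> v) * (u \<bullet> u) - (P \<bullet> u) * (u \<bullet> v) = g$3 * den"
    unfolding uu uv Pu Pv assms(6) using fg by algebra
  moreover have "(P \<bullet> u) * (v \<bullet> v) - (P \<bullet> v) * (u \<bullet> v) =
      g$3 * (p\<^sub>0 * (g \<bullet> g) + p \<bullet> cross3 g f)"
    unfolding vv uv Pu Pv gg using fg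
    by (simp add: inner_vec_def sum_3 cross3_def) algebra
  moreover have "p\<^sub>0 * (g \<bullet> g) + p \<bullet> cross3 g f = den * \<kappa>"
    using assms(7,13) by simp
  ultimately have w: "((P \<bullet> u) * (v \<bullet> v) - (P \<bullet> v) * (u \<bullet> v)) *\<^sub>R u
      + ((P \<bullet> v) * (u \<bullet> u) - (P \<bullet> u) * (u \<bullet> v)) *\<^sub>R v = (g$3 * den) *\<^sub>R z"
    by (simp add: z_def algebra_simps)
  have "z$4 = g$3"
    by (simp add: z_def u_def v_def quat_def)
  then have "z \<noteq> 0"
    using \<open>g$3 \<noteq> 0\<close> by auto
  \<comment> \<open>The factor \<open>g$3 * den\<close> may be negative; its sign is the overall
    sign \<sigma>.\<close>
  then have closest: "closest_points P (feasibility_cone h b) = {sgn (g$3 * den) *\<^sub>R sgn z}"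
    using closest_points_sphere_Int_span2[of P u v] \<open>g$3 \<noteq> 0\<close> \<open>den \<noteq> 0\<close>
      feasibility_cone_eq_sphere_Int_span[OF \<open>norm h = norm b\<close> assms(3,4,12)]
    by (simp add: w sgn_scaleR flip: u_def v_def)

  \<comment> \<open>The squares are those of the vector part of \<open>z\<close>; the last one makes
    the radicand positive.\<close>
  have "g \<bullet> g + 2 * \<kappa> * (f$1 * g$2 - f$2 * g$1) + \<kappa>\<^sup>2 * ((f$1)\<^sup>2 + (f$2)\<^sup>2) =
      (g$1 - \<kappa> * f$2)\<^sup>2 + (g$2 + \<kappa> * f$1)\<^sup>2 + (g$3)\<^sup>2"
    unfolding gg by algebra
  moreover have "\<dots> > 0"
    using \<open>g$3 \<noteq> 0\<close> by (intro add_nonneg_pos add_nonneg_nonneg) auto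
  ultimately have "R > 0"
    and R2: "R\<^sup>2 = g \<bullet> g + 2 * \<kappa> * (f$1 * g$2 - f$2 * g$1) + \<kappa>\<^sup>2 * ((f$1)\<^sup>2 + (f$2)\<^sup>2)"
    by (simp_all add: R_def)
  have ratio: "ratio = \<kappa> * g$3 / R" and n3: "n\<^sub>3 = g$3 / R"
    using assms(8,9) by (simp_all add: R_def)
  have "z \<bullet> z = \<kappa>\<^sup>2 * (u \<bullet> u) + 2 * \<kappa> * (u \<bullet> v) + v \<bullet> v"
    by (simp add: z_def inner_add inner_commute power2_eq_square algebra_simps)
  then have zz: "z \<bullet> z = \<kappa>\<^sup>2 * (g$3)\<^sup>2 + R\<^sup>2"
    by (simp add: R2 uu uv vv algebra_simps)
  have "ratio\<^sup>2 + 1 = (z \<bullet> z) / R\<^sup>2"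
    using \<open>R > 0\<close> by (simp add: ratio zz power_divide power_mult_distrib field_simps)
  then have s: "s = R / norm z"
    using \<open>R > 0\<close> by (simp add: assms(10) real_sqrt_divide norm_eq_sqrt_inner)
  define N where "N = norm z"
  have "N > 0"
    using \<open>z \<noteq> 0\<close> by (simp add: N_def)
  \<comment> \<open>With s = R / N, c becomes \<kappa> * g$3 / N and \<open>s * n\<^sub>3\<close>
    becomes g$3 / N, so \<open>g$3\<close> cancels in the middle components.\<close>
  have "sgn z = vector [c, (- c * f$2 + s * n\<^sub>3 * g$1) / g$3,
      (c * f$1 + s * n\<^sub>3 * g$2) / g$3, s * n\<^sub>3]"
    using \<open>R > 0\<close> \<open>N > 0\<close> \<open>g$3 \<noteq> 0\<close>
    unfolding assms(11) s n3 ratio sgn_div_norm N_def[symmetric] vec_eq_iff forall_4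
    by (simp add: z_def u_def v_def quat_def field_simps)
  moreover have "sgn (g$3 * den) \<in> {1, -1}"
    using \<open>g$3 \<noteq> 0\<close> \<open>den \<noteq> 0\<close> by (auto simp: sgn_if)
  ultimately show ?thesis
    using closest unfolding P_def by metis
qed

end
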